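(* Let $m$ be a positive integer and let $M,\Lambda_1,\dots,\Lambda_{m-1}$ be real numbers. Let $F(z)=\sum_{k=0}^{m-1}\bar z^k f_k(z)$ be a poly-analytic function of order $m$ on $\mathbb{D}$, where all $f_k$ are holomorphic on $\mathbb{D}$, satisfying $f_k(0)=0$ for $k\in\{0,1,\dots,m-1\}$ and $F_z(0)=1$. If $|f_0(z)|<M$ and $|f_k'(z)|\le\Lambda_k$ for $k\in\{1,\dots,m-1\}$, for all $z\in\mathbb{D}$, then $\Lambda_k\ge0$, $M\ge1$, $F$ is univalent in $\mathbb{D}_{r_2}$, and $F(\mathbb{D}_{r_2})$ contains a schlicht disc $\mathbb{D}_{R_2}$, where $r_2$ is the unique root in $(0,1)$ of the equation $$1-\left(M-\frac1M\right)\frac{2r-r^2}{(1-r)^2}-\sum_{k=1}^{m-1}(k+1)r^k\Lambda_k=0$$ and $$R_2=r_2-\left(M-\frac1M\right)\frac{r_2^2}{1-r_2}-\sum_{k=1}^{m-1}r_2^{k+1}\Lambda_k.$$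
   Context: $\mathbb{D}=\{z\in\mathbb{C}:|z|<1\}$ and $\mathbb{D}_r=\{z\in\mathbb{C}:|z|<r\}$. A complex-valued $C^m$ function $F$ on a domain is poly-analytic of order $m\ge1$ if $\partial^m F/\partial\bar z^m=0$; equivalently $F(z)=\sum_{k=0}^{m-1}\bar z^k f_k(z)$ with $f_k$ analytic. $F_z=\partial F/\partial z$ is the Wirtinger derivative. Univalent means injective. "$F(\mathbb{D}_{r})$ contains a schlicht disc $\mathbb{D}_{R}$" means that some subdomain of $\mathbb{D}_r$ is mapped injectively by $F$ onto $\mathbb{D}_R$; as $F$ is univalent in $\mathbb{D}_r$ this amounts to $\mathbb{D}_R\subseteq F(\mathbb{D}_r)$. Empty sums are $0$.
   Formalization: The root r_2 is asserted to exist (uniquely) only if M>1 or the sum of (k+1)Λ_k over k=1..m-1 exceeds 1; otherwise (e.g. m=1, M=1, F(z)=z) the equation has no root in (0,1). Univalence and the schlicht disc are proved for every root r_2. *)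

theory Defs
  imports "HOL-Complex_Analysis.Complex_Analysis"
begin

text \<open>The Wirtinger derivative \<open>\<partial>F/\<partial>z = (F\<^sub>x - i F\<^sub>y) / 2\<close>, with \<open>F\<^sub>x\<close> and \<open>F\<^sub>y\<close> the partial
  derivatives of \<open>F\<close> in the real coordinates. It is meaningful only where these exist.\<close>

definition wirtinger_z :: "(complex \<Rightarrow> complex) \<Rightarrow> complex \<Rightarrow> complex" where
  "wirtinger_z F z =
     (vector_derivative (\<lambda>t::real. F (z + of_real t)) (at 0)
      - \<i> * vector_derivative (\<lambda>t::real. F (z + \<i> * of_real t)) (at 0)) / 2"

text \<open>A domain is nonempty by convention, so this entails \<open>R > 0\<close>.\<close>

definition contains_schlicht_disc ::
  "(complex \<Rightarrow> complex) \<Rightarrow> complex set \<Rightarrow> real \<Rightarrow> bool" where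
  "contains_schlicht_disc F S R \<longleftrightarrow>
     (\<exists>U. U \<subseteq> S \<and> open U \<and> connected U \<and> U \<noteq> {} \<and> inj_on F U \<and> F ` U = ball 0 R)"

text \<open>For \<open>M = 1\<close> and \<open>(\<Sum>k\<in>{1..<m}. (k + 1) * \<Lambda> k) \<le> 1\<close> (e.g. when \<open>F z = z\<close> and all \<open>\<Lambda> k\<close> vanish)
  the equation has no root in \<open>(0, 1)\<close>, so the existence of a root needs that case excluded.\<close>

definition is_univalence_radius :: "nat \<Rightarrow> real \<Rightarrow> (nat \<Rightarrow> real) \<Rightarrow> real \<Rightarrow> bool" where
  "is_univalence_radius m M \<Lambda> r \<longleftrightarrow>
     0 < r \<and> r < 1 \<and>
     1 - (M - 1 / M) * ((2 * r - r\<^sup>2) / (1 - r)\<^sup>2)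
       - (\<Sum>k\<in>{1..<m}. (real k + 1) * r ^ k * \<Lambda> k) = 0"

end

theory Submission imports Defs begin

text \<open>
  Write \<open>f\<^sub>0(z) = z + a\<^sub>2 z\<^sup>2 + \<dots>\<close>; indeed \<open>F\<^sub>z(0) = f\<^sub>0'(0)\<close>, since \<open>f\<^sub>k(0) = 0\<close> makes the terms with
  \<open>k \<ge> 1\<close> quadratically small. By the Schwarz lemma \<open>h(z) = f\<^sub>0(z) / (M z)\<close> is bounded by \<open>1\<close>, and
  \<open>h(0) = 1 / M\<close>. Averaging \<open>h\<close> over the \<open>n\<close>-th roots of unity leaves a function of \<open>z\<^sup>n\<close> whose linear
  coefficient is \<open>a\<^bsub>n+1\<^esub> / M\<close>, so that Schwarz--Pick at the origin gives \<open>\<bar>a\<^bsub>n+1\<^esub>\<bar> \<le> M - 1 / M\<close>.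
  Summing the power series, \<open>\<bar>F(z) - F(w) - (z - w)\<bar> \<le> \<phi>(\<rho>) \<bar>z - w\<bar>\<close> for \<open>\<bar>z\<bar>, \<bar>w\<bar> \<le> \<rho>\<close>, where
  \<open>1 - \<phi>(r)\<close> is the left-hand side of the equation for \<open>r\<^sub>2\<close>. As \<open>\<phi>(r) / r\<close> is nondecreasing and
  \<open>\<phi>(r\<^sub>2) = 1\<close>, \<open>F - id\<close> is a strict contraction for \<open>\<rho> < r\<^sub>2\<close>, whence univalence. The same
  coefficient bound gives \<open>\<bar>F\<bar> \<ge> R\<^sub>2\<close> on the circle \<open>\<bar>z\<bar> = r\<^sub>2\<close>, so the part of the image inside
  \<open>\<bar>w\<bar> < R\<^sub>2\<close> is closed there; it is also open by invariance of domain, hence everything.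
\<close>

section \<open>Coefficients of bounded holomorphic functions on the unit disc\<close>

text \<open>The disc automorphism taking \<open>h 0\<close> to \<open>0\<close> turns
  \<open>h\<close> into a self-map of the disc fixing the origin. The Schwarz lemma bounds its
  derivative at \<open>0\<close>, which is \<open>deriv h 0\<close> divided by
  \<open>1 - norm (h 0) ^ 2\<close>.\<close>

lemma Schwarz_Pick_at_0:
  assumes hol: "h holomorphic_on ball 0 1"
    and lt: "\<And>z. norm z < 1 \<Longrightarrow> norm (h z) < 1"
  shows "norm (deriv h 0) \<le> 1 - norm (h 0) ^ 2"
proof -
  define b where "b = h 0"
  have b: "norm b < 1" using lt[of 0] by (simp add: b_def)
  have nz: "1 - cnj b * h z \<noteq> 0" if "norm z < 1" for z
  proof
    assume "1 - cnj b * h z = 0"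
    then have "norm (cnj b * h z) = 1" by (metis eq_iff_diff_eq_0 norm_one)
    then show False using norm_mult_less[of "cnj b" 1 "h z" 1] b lt[OF that] by simp
  qed
  define g where "g = (\<lambda>z. Moebius_function 0 b (h z))"
  have g: "g = (\<lambda>z. (h z - b) / (1 - cnj b * h z))"
    by (simp add: g_def Moebius_function_simple)
  have "norm (deriv g 0) \<le> 1"
  proof (rule Schwarz_Lemma(2))
    show "g holomorphic_on ball 0 1"
      unfolding g using nz by (intro holomorphic_intros hol) auto
    show "g 0 = 0" by (simp add: g b_def)
    show "norm (g z) < 1" if "norm z < 1" for z
      unfolding g_def by (intro Moebius_function_norm_lt_1 b lt that)
    show "norm (0::complex) < 1" by simp
  qed
  moreover have "deriv g 0 = deriv h 0 / (1 - norm b ^ 2)"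
  proof -
    have "(h has_field_derivative deriv h 0) (at 0)"
      using hol holomorphic_derivI[of h "ball 0 1" 0] by simp
    then have "(g has_field_derivative
        (deriv h 0 * (1 - cnj b * h 0) + (h 0 - b) * (cnj b * deriv h 0)) / ((1 - cnj b * h 0) * (1 - cnj b * h 0))) (at 0)"
      unfolding g using nz[of 0] by (auto intro!: derivative_eq_intros)
    then have "deriv g 0 = deriv h 0 / (1 - cnj b * b)"
      using nz[of 0] by (auto dest!: DERIV_imp_deriv simp: b_def)
    moreover have "cnj b * b = of_real (norm b) ^ 2"
      by (metis complex_norm_square mult.commute of_real_power)
    ultimately show ?thesis by simp
  qed
  moreover have pos: "1 - norm b ^ 2 > 0"
    using b by (simp add: power_less_one_iff abs_square_less_1)
  moreover have "norm (1 - complex_of_real (norm b) ^ 2) = 1 - norm b ^ 2"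
    using pos by (metis abs_of_pos norm_of_real of_real_1 of_real_diff of_real_power)
  ultimately have "norm (deriv h 0) / (1 - norm b ^ 2) \<le> 1"
    by (simp add: norm_divide)
  with pos show ?thesis by (simp add: b_def divide_simps split: if_splits)
qed

lemma sum_power_roots_unity:
  fixes n k :: nat
  assumes "n > 0"
  shows "(\<Sum>j<n. cis (2 * pi * real j / real n) ^ k) = (if n dvd k then of_nat n else 0)"
proof -
  define \<omega> where "\<omega> = cis (2 * pi / real n)"
  have \<omega>: "cis (2 * pi * real j / real n) = \<omega> ^ j" for j
    unfolding \<omega>_def Complex.DeMoivre by (rule arg_cong[where f = cis]) simp
  have "\<omega> ^ n = 1" using assms by (simp add: \<omega>_def Complex.DeMoivre complex_eq_iff)
  have eq: "(\<Sum>j<n. cis (2 * pi * real j / real n) ^ k) = (\<Sum>j<n. (\<omega> ^ k) ^ j)"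
    unfolding \<omega> by (simp add: mult.commute flip: power_mult)
  show ?thesis
  proof (cases "\<omega> ^ k = 1")
    case True
    \<comment> \<open>Distinctness of the first \<open>n\<close> powers makes the order of
      \<open>\<omega>\<close> exactly \<open>n\<close>.\<close>
    have inj: "inj_on (\<lambda>j. \<omega> ^ j) {..<n}"
      using Complex.bij_betw_roots_unity[OF assms] unfolding \<omega> by (simp add: bij_betw_def)
    have "\<omega> ^ (k mod n) = \<omega> ^ 0"
    proof -
      have "\<omega> ^ k = (\<omega> ^ n) ^ (k div n) * \<omega> ^ (k mod n)"
        by (metis mult_div_mod_eq power_add power_mult)
      then show ?thesis using True \<open>\<omega> ^ n = 1\<close> by simp
    qed
    then have "k mod n = 0" using inj_onD[OF inj, of "k mod n" 0] assms by simp
    then show ?thesis unfolding eq using True by auto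
  next
    case False
    then have "\<not> n dvd k" using \<open>\<omega> ^ n = 1\<close> by (auto simp: power_mult)
    moreover have "(\<omega> ^ k) ^ n = 1"
      using \<open>\<omega> ^ n = 1\<close> by (metis mult.commute power_mult power_one)
    ultimately show ?thesis unfolding eq using False by (subst geometric_sum) auto
  qed
qed

text \<open>Averaging over the rotations by \<open>n\<close>-th roots of unity annihilates every
  coefficient whose index is not a multiple of \<open>n\<close>.\<close>

lemma multisection_sums:
  fixes a :: "nat \<Rightarrow> complex"
  assumes n: "n > 0"
    and sums: "\<And>z. norm z < 1 \<Longrightarrow> (\<lambda>k. a k * z ^ k) sums h z"
    and z: "norm z < 1"
  shows "(\<lambda>k. a (n * k) * (z ^ n) ^ k) sums
           ((\<Sum>j<n. h (cis (2 * pi * real j / real n) * z)) / of_nat n)"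
proof -
  have "(\<lambda>k. \<Sum>j<n. a k * (cis (2 * pi * real j / real n) * z) ^ k) sums
          (\<Sum>j<n. h (cis (2 * pi * real j / real n) * z))"
    by (intro sums_sum sums) (simp add: norm_mult z)
  then have "(\<lambda>k. (\<Sum>j<n. a k * (cis (2 * pi * real j / real n) * z) ^ k) / of_nat n) sums
          ((\<Sum>j<n. h (cis (2 * pi * real j / real n) * z)) / of_nat n)"
    by (rule sums_divide)
  also have "(\<lambda>k. (\<Sum>j<n. a k * (cis (2 * pi * real j / real n) * z) ^ k) / of_nat n)
      = (\<lambda>k. if n dvd k then a k * z ^ k else 0)"
  proof
    fix k
    have "(\<Sum>j<n. a k * (cis (2 * pi * real j / real n) * z) ^ k)
        = a k * z ^ k * (\<Sum>j<n. cis (2 * pi * real j / real n) ^ k)"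
      by (simp add: sum_distrib_left power_mult_distrib mult_ac)
    then show "(\<Sum>j<n. a k * (cis (2 * pi * real j / real n) * z) ^ k) / of_nat n
        = (if n dvd k then a k * z ^ k else 0)"
      using n by (simp add: sum_power_roots_unity)
  qed
  finally have "(\<lambda>k. if n dvd n * k then a (n * k) * z ^ (n * k) else 0) sums
          ((\<Sum>j<n. h (cis (2 * pi * real j / real n) * z)) / of_nat n)"
    by (subst sums_mono_reindex) (use n in \<open>auto simp: strict_mono_def\<close>)
  then show ?thesis by (simp add: power_mult)
qed

text \<open>Averaging preserves the bound \<open>1\<close> and moves the coefficient
  \<open>a n\<close> into the linear position, where Schwarz-Pick at the origin controls it.\<close>

lemma coeff_bound_of_bounded_by_1:
  fixes a :: "nat \<Rightarrow> complex"
  assumes sums: "\<And>z. norm z < 1 \<Longrightarrow> (\<lambda>k. a k * z ^ k) sums h z"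
    and le: "\<And>z. norm z < 1 \<Longrightarrow> norm (h z) \<le> 1"
    and n: "n > 0"
  shows "norm (a n) \<le> 1 - norm (a 0) ^ 2"
proof -
  \<comment> \<open>The average is a function of \<open>z\<close>, whereas \<open>g\<close> must
    depend on \<open>w = z ^ n\<close>. As a power series it does so without a choice of root, and
    it can be differentiated termwise.\<close>
  define g where "g = (\<lambda>w. \<Sum>k. a (n * k) * w ^ k)"
  have g: "(\<lambda>k. a (n * k) * w ^ k) sums g w \<and> norm (g w) \<le> 1" if w: "norm w < 1" for w
  proof -
    obtain z where z: "w = z ^ n"
      using n by (metis exists_complex_root neq0_conv)
    then have "norm z < 1"
      using w n by (metis norm_power norm_ge_zero not_less one_le_power)
    then have s: "(\<lambda>k. a (n * k) * w ^ k) sums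
           ((\<Sum>j<n. h (cis (2 * pi * real j / real n) * z)) / of_nat n)"
      unfolding z by (intro multisection_sums[OF n] sums)
    have "norm (\<Sum>j<n. h (cis (2 * pi * real j / real n) * z)) \<le> (\<Sum>j<n. 1)"
      by (rule order_trans[OF norm_sum], intro sum_mono le)
        (simp add: norm_mult \<open>norm z < 1\<close>)
    then have "norm ((\<Sum>j<n. h (cis (2 * pi * real j / real n) * z)) / of_nat n) \<le> 1"
      using n by (simp add: norm_divide divide_simps)
    with s show ?thesis by (auto simp: g_def sums_iff)
  qed
  have der: "(g has_field_derivative (\<Sum>k. diffs (\<lambda>k. a (n * k)) k * w ^ k)) (at w)"
    if "norm w < 1" for w
    unfolding g_def by (rule termdiffs_strong'[where K = 1]) (use g that in \<open>auto simp: sums_iff\<close>)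
  have g0: "g 0 = a 0" by (simp add: g_def powser_zero)
  have g'0: "(g has_field_derivative a n) (at 0)"
    using der[of 0] by (simp add: powser_zero diffs_def)
  \<comment> \<open>Scaling by \<open>t < 1\<close> yields the strict bound that Schwarz--Pick needs.\<close>
  have bd: "t * norm (a n) \<le> 1 - (t * norm (a 0)) ^ 2" if t: "0 < t" "t < 1" for t :: real
  proof -
    have "norm (deriv (\<lambda>w. of_real t * g w) 0) \<le> 1 - norm (of_real t * g 0) ^ 2"
    proof (rule Schwarz_Pick_at_0)
      have "g holomorphic_on ball 0 1"
        unfolding holomorphic_on_open[OF open_ball] using der by (metis dist_0_norm mem_ball)
      then show "(\<lambda>w. of_real t * g w) holomorphic_on ball 0 1"
        by (intro holomorphic_intros)
      show "norm (of_real t * g w) < 1" if "norm w < 1" for w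
      proof -
        have "norm (of_real t * g w) = t * norm (g w)" using t by (simp add: norm_mult)
        also have "\<dots> \<le> t" using g[OF that] t by (simp add: mult_left_le)
        finally show ?thesis using t by simp
      qed
    qed
    moreover have "deriv (\<lambda>w. of_real t * g w) 0 = of_real t * a n"
      by (intro DERIV_imp_deriv DERIV_cmult g'0)
    ultimately show ?thesis using t by (simp add: norm_mult g0)
  qed
  have "eventually (\<lambda>t::real. t * norm (a n) \<le> 1 - (t * norm (a 0)) ^ 2) (at_left 1)"
    using eventually_at_left_real[of 0 1] by (auto elim!: eventually_mono intro!: bd)
  moreover have "((\<lambda>t::real. t * norm (a n)) \<longlongrightarrow> 1 * norm (a n)) (at_left 1)"
    "((\<lambda>t::real. 1 - (t * norm (a 0)) ^ 2) \<longlongrightarrow> 1 - (1 * norm (a 0)) ^ 2) (at_left 1)"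
    by (intro tendsto_intros)+
  ultimately have "1 * norm (a n) \<le> 1 - (1 * norm (a 0)) ^ 2"
    by (intro tendsto_le[of "at_left (1::real)"]) auto
  then show ?thesis by simp
qed

section \<open>Growth and distortion of normalized bounded functions\<close>

text \<open>The bound \<open>1 - 1 / M\<^sup>2\<close> on the coefficients of
  \<open>f z / (M z)\<close> becomes \<open>M - 1 / M\<close> after multiplication by
  \<open>M\<close>. The Schwarz bound on the derivative of \<open>f / M\<close> at \<open>0\<close>
  gives \<open>1 / M \<le> 1\<close>.\<close>

lemma normalized_bounded_coeffs:
  assumes hol: "f holomorphic_on ball 0 1"
    and f0: "f 0 = 0" and f'0: "deriv f 0 = 1"
    and lt: "\<And>z. norm z < 1 \<Longrightarrow> norm (f z) < M"
  shows "M \<ge> 1" and "\<And>n. n \<ge> 2 \<Longrightarrow> norm ((deriv ^^ n) f 0 / fact n) \<le> M - 1 / M"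
proof -
  define a where "a n = (deriv ^^ n) f 0 / fact n" for n
  have a0: "a 0 = 0" and a1: "a 1 = 1" by (simp_all add: a_def f0 f'0)
  have M: "M > 0" using lt[of 0] f0 by simp
  have sums: "(\<lambda>n. a n * z ^ n) sums f z" if "norm z < 1" for z
    using holomorphic_power_series[OF hol, of z] that by (simp add: a_def)
  define g where "g z = f z / of_real M" for z
  have g: "g holomorphic_on ball 0 1" "g 0 = 0" "\<And>z. norm z < 1 \<Longrightarrow> norm (g z) < 1"
    unfolding g_def using M lt f0
    by (auto intro!: holomorphic_intros hol simp: norm_divide divide_simps)
  have "(f has_field_derivative 1) (at 0)"
    using hol holomorphic_derivI[of f "ball 0 1" 0] f'0 by simp
  then have "deriv g 0 = 1 / of_real M"
    unfolding g_def by (intro DERIV_imp_deriv DERIV_cdivide)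
  moreover have "norm (deriv g 0) \<le> 1"
    by (rule Schwarz_Lemma(2)[of g 0]) (use g in simp_all)
  ultimately have "1 / M \<le> 1" using M by (simp add: norm_divide)
  then show M1: "M \<ge> 1" using M by (simp add: divide_simps split: if_splits)
  have le: "norm (g z) \<le> norm z" if "norm z < 1" for z
    by (rule Schwarz_Lemma(1)[of g]) (use g that in simp_all)
  \<comment> \<open>The value at \<open>0\<close> fills the removable singularity with
    \<open>deriv g 0\<close>.\<close>
  define h where "h z = (if z = 0 then 1 / of_real M else g z / z)" for z
  have hs: "(\<lambda>n. (a (Suc n) / of_real M) * z ^ n) sums h z" if "norm z < 1" for z
  proof (cases "z = 0")
    case True
    then show ?thesis
      using powser_sums_zero[of "\<lambda>n. a (Suc n) / of_real M"] a1 by (simp add: h_def)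
  next
    case False
    have "(\<lambda>n. a (Suc n) * z ^ Suc n) sums f z"
      using sums[OF that] a0 by (subst sums_Suc_iff) simp
    then have "(\<lambda>n. a (Suc n) * z ^ Suc n / (of_real M * z)) sums (f z / (of_real M * z))"
      by (rule sums_divide)
    then show ?thesis using False M by (simp add: h_def g_def field_simps)
  qed
  have h1: "norm (h z) \<le> 1" if "norm z < 1" for z
    using le[OF that] M1 by (auto simp: h_def norm_divide divide_simps)
  fix n :: nat assume n: "n \<ge> 2"
  \<comment> \<open>Dividing by \<open>z\<close> shifts indices down by one;
    \<open>n \<ge> 2\<close> keeps the shifted index positive.\<close>
  have "norm (a (Suc (n - 1)) / of_real M) \<le> 1 - norm (a (Suc 0) / of_real M) ^ 2"
    by (rule coeff_bound_of_bounded_by_1[of "\<lambda>n. a (Suc n) / of_real M" h]) (use hs h1 n in auto)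
  then have "norm (a n) \<le> M - 1 / M"
    using n M a1 by (simp add: norm_divide divide_simps power2_eq_square mult_ac)
  then show "norm ((deriv ^^ n) f 0 / fact n) \<le> M - 1 / M" by (simp add: a_def)
qed

text \<open>Subtracting \<open>z\<close> leaves only coefficients of index at least
  \<open>2\<close>, each at most \<open>M - 1 / M\<close> in norm. The geometric series and its
  derivative then majorize the two remainders.\<close>

lemma normalized_bounded_estimates:
  assumes hol: "f holomorphic_on ball 0 1"
    and f0: "f 0 = 0" and f'0: "deriv f 0 = 1"
    and lt: "\<And>z. norm z < 1 \<Longrightarrow> norm (f z) < M"
    and z: "norm z < 1"
  shows "norm (f z - z) \<le> (M - 1 / M) * ((norm z)\<^sup>2 / (1 - norm z))"
    and "norm (deriv f z - 1) \<le> (M - 1 / M) * ((2 * norm z - (norm z)\<^sup>2) / (1 - norm z)\<^sup>2)"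
proof -
  define a where "a n = (deriv ^^ n) f 0 / fact n" for n
  define c where "c = M - 1 / M"
  define r where "r = norm z"
  have r: "0 \<le> r" "r < 1" using z by (auto simp: r_def)
  have a0: "a 0 = 0" and a1: "a 1 = 1" by (simp_all add: a_def f0 f'0)
  have a: "norm (a (n + 2)) \<le> c" for n
    using normalized_bounded_coeffs(2)[OF hol f0 f'0 lt, of "n + 2"] by (simp add: a_def c_def)
  have "(\<lambda>n. a n * z ^ n) sums f z"
    using holomorphic_power_series[OF hol, of z] z by (simp add: a_def)
  then have "(\<lambda>n. a (n + 2) * z ^ (n + 2)) sums (f z - z)"
    using a0 a1 by (subst sums_iff_shift) (simp add: numeral_2_eq_2)
  moreover have "(\<lambda>n. c * r\<^sup>2 * r ^ n) sums (c * r\<^sup>2 * (1 / (1 - r)))"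
    using r by (intro sums_mult geometric_sums) simp
  moreover have "norm (a (n + 2) * z ^ (n + 2)) \<le> c * r\<^sup>2 * r ^ n" for n
  proof -
    have "norm (a (n + 2) * z ^ (n + 2)) = norm (a (n + 2)) * r ^ (n + 2)"
      by (simp only: norm_mult norm_power r_def)
    also have "\<dots> \<le> c * r ^ (n + 2)" using r by (intro mult_right_mono a) auto
    finally show ?thesis by (simp add: power_add power2_eq_square mult_ac)
  qed
  ultimately have "norm (f z - z) \<le> c * r\<^sup>2 * (1 / (1 - r))"
    by (rule norm_sums_le)
  then show "norm (f z - z) \<le> (M - 1 / M) * ((norm z)\<^sup>2 / (1 - norm z))"
    by (simp add: c_def r_def)
  have a': "(deriv ^^ n) (deriv f) 0 / fact n = of_nat (Suc n) * a (Suc n)" for n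
    unfolding a_def fact_Suc funpow_Suc_right using of_nat_neq_0[of n, where 'a = complex]
    by (simp add: divide_simps del: of_nat_Suc)
  have "deriv f holomorphic_on ball 0 1" by (intro holomorphic_deriv hol) simp
  from holomorphic_power_series[OF this, of z] z
  have "(\<lambda>n. of_nat (Suc n) * a (Suc n) * z ^ n) sums deriv f z" by (simp only: a') simp
  then have "(\<lambda>n. of_nat (Suc (n + 1)) * a (n + 2) * z ^ (n + 1)) sums (deriv f z - 1)"
    using a1 sums_iff_shift[of "\<lambda>n. of_nat (Suc n) * a (Suc n) * z ^ n" 1] by simp
  \<comment> \<open>This is the differentiated geometric series without its constant term, whence
    the \<open>- 1\<close> in the sum.\<close>
  moreover have "(\<lambda>n. c * (of_nat (Suc (n + 1)) * r ^ (n + 1))) sums (c * (1 / (1 - r)\<^sup>2 - 1))"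
    using geometric_deriv_sums[of r] r sums_iff_shift[of "\<lambda>n. of_nat (Suc n) * r ^ n" 1 ]
    by (intro sums_mult) simp
  moreover have "norm (of_nat (Suc (n + 1)) * a (n + 2) * z ^ (n + 1))
      \<le> c * (of_nat (Suc (n + 1)) * r ^ (n + 1))" for n
  proof -
    have "norm (of_nat (Suc (n + 1)) * a (n + 2) * z ^ (n + 1))
        = norm (a (n + 2)) * (of_nat (Suc (n + 1)) * r ^ (n + 1))"
      by (simp only: norm_mult norm_power r_def norm_of_nat mult_ac)
    also have "\<dots> \<le> c * (of_nat (Suc (n + 1)) * r ^ (n + 1))"
      using r by (intro mult_right_mono a) auto
    finally show ?thesis .
  qed
  ultimately have "norm (deriv f z - 1) \<le> c * (1 / (1 - r)\<^sup>2 - 1)"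
    by (rule norm_sums_le)
  also have "1 / (1 - r)\<^sup>2 - 1 = (2 * r - r\<^sup>2) / (1 - r)\<^sup>2"
    using r by (simp add: divide_simps) (simp add: power2_eq_square algebra_simps)
  finally show "norm (deriv f z - 1) \<le> (M - 1 / M) * ((2 * norm z - (norm z)\<^sup>2) / (1 - norm z)\<^sup>2)"
    by (simp add: c_def r_def)
qed

section \<open>Poly-analytic terms: the derivative at the origin and Lipschitz bounds\<close>

lemma wirtinger_z_0:
  assumes m: "m \<ge> 1"
    and hol: "\<And>k. k < m \<Longrightarrow> f k holomorphic_on ball 0 1"
    and F: "\<And>z. z \<in> ball 0 1 \<Longrightarrow> F z = (\<Sum>k<m. cnj z ^ k * f k z)"
    and f0: "\<And>k. k < m \<Longrightarrow> f k 0 = 0"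
  shows "wirtinger_z F 0 = deriv (f 0) 0"
proof -
  have *: "((\<lambda>t::real. F (e * of_real t)) has_vector_derivative deriv (f 0) 0 * e) (at 0)"
    if e: "norm e = 1" for e
  proof -
    \<comment> \<open>For real \<open>t\<close>, the conjugate of \<open>e * t\<close> is
      \<open>cnj e * t\<close>, so a complex \<open>w\<close> in place of \<open>t\<close> makes
      each term holomorphic. As \<open>f k 0 = 0\<close>, only the derivative of \<open>f k\<close>
      survives, with factor \<open>0 ^ k\<close>, which is \<open>1\<close> for \<open>k = 0\<close>
      and \<open>0\<close> otherwise.\<close>
    have "((\<lambda>w. (cnj e * w) ^ k * f k (e * w)) has_field_derivative 0 ^ k * (deriv (f k) 0 * e)) (at 0)"
      if "k < m" for k
    proof -
      have "(f k has_field_derivative deriv (f k) 0) (at (e * 0))"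
        using holomorphic_derivI[OF hol[OF that], of 0] by simp
      then have "((\<lambda>w. f k (e * w)) has_field_derivative deriv (f k) 0 * e) (at 0)"
        by (rule DERIV_chain2) (auto intro!: derivative_eq_intros)
      moreover have "((\<lambda>w. (cnj e * w) ^ k) has_field_derivative of_nat k * (cnj e * 0) ^ (k - 1) * cnj e) (at 0)"
        by (auto intro!: derivative_eq_intros)
      ultimately show ?thesis
        using DERIV_mult[of "\<lambda>w. (cnj e * w) ^ k" _ 0 UNIV "\<lambda>w. f k (e * w)" "deriv (f k) 0 * e"]
          f0[OF that] by (simp add: mult_ac)
    qed
    then have "((\<lambda>w. \<Sum>k<m. (cnj e * w) ^ k * f k (e * w)) has_field_derivative
        (\<Sum>k<m. 0 ^ k * (deriv (f k) 0 * e))) (at 0)"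
      by (intro DERIV_sum) auto
    also have "(\<Sum>k<m. 0 ^ k * (deriv (f k) 0 * e)) = (\<Sum>k\<in>{0}. 0 ^ k * (deriv (f k) 0 * e))"
      using m by (intro sum.mono_neutral_right) auto
    finally have "((\<lambda>t::real. \<Sum>k<m. (cnj e * of_real t) ^ k * f k (e * of_real t))
        has_vector_derivative deriv (f 0) 0 * e) (at 0)"
      using has_vector_derivative_real_field[of _ _ 0] by simp
    then show ?thesis
      by (rule has_vector_derivative_transform_within_open[where S = "ball 0 1"])
        (use F e in \<open>auto simp: norm_mult\<close>)
  qed
  have "vector_derivative (\<lambda>t::real. F (0 + of_real t)) (at 0) = deriv (f 0) 0"
    "vector_derivative (\<lambda>t::real. F (0 + \<i> * of_real t)) (at 0) = \<i> * deriv (f 0) 0"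
    using *[of 1] *[of \<i>] by (auto intro!: vector_derivative_at simp: mult.commute)
  then show ?thesis by (simp add: wirtinger_z_def)
qed

text \<open>The difference splits as in the product rule. Varying \<open>f\<close> contributes
  \<open>\<rho> ^ k * L\<close>; varying the power contributes \<open>k\<close> times as much,
  because \<open>f 0 = 0\<close> gives \<open>norm (f w) \<le> L * \<rho>\<close>. This is the
  source of the factor \<open>k + 1\<close> in the equation for the radius.\<close>

lemma conj_power_mult_diff_bound:
  assumes hol: "f holomorphic_on ball 0 1" and f0: "f 0 = 0"
    and bd: "\<And>z. norm z < 1 \<Longrightarrow> norm (deriv f z) \<le> L"
    and \<rho>: "\<rho> < 1" and z: "norm z \<le> \<rho>" and w: "norm w \<le> \<rho>"
  shows "norm (cnj z ^ k * f z - cnj w ^ k * f w) \<le> (real k + 1) * \<rho> ^ k * L * norm (z - w)"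
proof -
  have lip: "norm (f u - f v) \<le> L * norm (u - v)" if "norm u < 1" "norm v < 1" for u v
  proof (rule field_differentiable_bound[where S = "ball 0 1" and f' = "deriv f"])
    show "(f has_field_derivative deriv f z) (at z within ball 0 1)" if "z \<in> ball 0 1" for z
      by (rule has_field_derivative_at_within, rule holomorphic_derivI[OF hol open_ball that])
    show "norm (deriv f z) \<le> L" if "z \<in> ball 0 1" for z using bd that by simp
  qed (use that in simp_all)
  have \<rho>0: "\<rho> \<ge> 0" using z norm_ge_zero order_trans by blast
  have L: "L \<ge> 0" using order_trans[OF norm_ge_zero bd[of 0]] by simp
  have "cnj z ^ k * f z - cnj w ^ k * f w = cnj z ^ k * (f z - f w) + (cnj z ^ k - cnj w ^ k) * f w"
    by (simp add: algebra_simps)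
  also have "norm \<dots> \<le> norm (cnj z ^ k * (f z - f w)) + norm ((cnj z ^ k - cnj w ^ k) * f w)"
    by (rule norm_triangle_ineq)
  also have "norm (cnj z ^ k * (f z - f w)) \<le> \<rho> ^ k * (L * norm (z - w))"
    unfolding norm_mult norm_power using z w \<rho> \<rho>0
    by (intro mult_mono power_mono lip) auto
  also have "norm ((cnj z ^ k - cnj w ^ k) * f w) \<le> (k * \<rho> ^ (k - 1) * norm (z - w)) * (L * \<rho>)"
    unfolding norm_mult
  proof (rule mult_mono)
    \<comment> \<open>Conjugation preserves the norm, so the mean value bound can be applied to the
      holomorphic power.\<close>
    have "norm (cnj z ^ k - cnj w ^ k) = norm (z ^ k - w ^ k)"
      by (simp flip: complex_cnj_power complex_cnj_diff)
    also have "\<dots> \<le> (k * \<rho> ^ (k - 1)) * norm (z - w)"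
      by (rule field_differentiable_bound[where S = "cball 0 \<rho>" and f' = "\<lambda>z. of_nat k * z ^ (k - 1)"])
        (use z w in \<open>auto intro!: derivative_eq_intros mult_left_mono power_mono simp: norm_mult norm_power\<close>)
    finally show "norm (cnj z ^ k - cnj w ^ k) \<le> k * \<rho> ^ (k - 1) * norm (z - w)" .
    have "norm (f w) \<le> L * norm w" using lip[of w 0] w \<rho> f0 by simp
    also have "\<dots> \<le> L * \<rho>" using w L by (intro mult_left_mono)
    finally show "norm (f w) \<le> L * \<rho>" .
  qed (use \<rho>0 in auto)
  also have "\<rho> ^ k * (L * norm (z - w)) + (k * \<rho> ^ (k - 1) * norm (z - w)) * (L * \<rho>)
      = (real k + 1) * \<rho> ^ k * L * norm (z - w)"
    \<comment> \<open>For \<open>k = 0\<close> the exponent \<open>k - 1\<close> is truncated to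
      \<open>0\<close>, but the factor \<open>k\<close> removes that term.\<close>
    by (cases k) (simp_all add: algebra_simps)
  finally show ?thesis by simp
qed

section \<open>From a bound on the circle to a schlicht disc\<close>

text \<open>A poly-analytic \<open>F\<close> need not be holomorphic, so openness of the image comes
  from injectivity and invariance of domain, not from the open mapping theorem.\<close>

lemma contains_schlicht_disc_if_boundary_bound:
  assumes cont: "continuous_on (cball 0 r) F" and inj: "inj_on F (ball 0 r)"
    and F0: "F 0 = 0" and r: "r > 0" and R: "R > 0"
    and bd: "\<And>z. norm z = r \<Longrightarrow> R \<le> norm (F z)"
  shows "contains_schlicht_disc F (ball 0 r) R"
proof -
  have contb: "continuous_on (ball 0 r) F" by (rule continuous_on_subset[OF cont]) auto
  have op: "open (F ` ball 0 r)" by (intro invariance_of_domain contb inj) simp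
  have cl: "closed (F ` cball 0 r)" by (intro compact_imp_closed compact_continuous_image cont) simp
  \<comment> \<open>The circle is mapped outside \<open>ball 0 R\<close>, so the compact image and
    the open image agree inside it.\<close>
  have eq: "F ` cball 0 r \<inter> ball 0 R = F ` ball 0 r \<inter> ball 0 R"
    using bd by (force simp: le_less image_iff)
  have sub: "ball 0 R \<subseteq> F ` ball 0 r"
  proof -
    have "openin (top_of_set (ball 0 R)) (F ` ball 0 r \<inter> ball 0 R)"
      using op by (metis Int_commute openin_open_Int)
    moreover have "closedin (top_of_set (ball 0 R)) (F ` ball 0 r \<inter> ball 0 R)"
      using cl eq by (metis Int_commute closedin_closed_Int)
    moreover have "0 \<in> F ` ball 0 r \<inter> ball 0 R" using F0 r R by force
    ultimately show ?thesis
      using connected_clopen[of "ball (0::complex) R"] connected_ball[of "0::complex" R] by blast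
  qed
  obtain g where g: "homeomorphism (ball 0 r) (F ` ball 0 r) F g"
    using invariance_of_domain_homeomorphism[OF open_ball contb _ inj] by auto
  define U where "U = g ` ball 0 R"
  \<comment> \<open>Both descriptions of \<open>U\<close> are used: as a continuous image under
    \<open>g\<close> it is connected, as a preimage under \<open>F\<close> it is open.\<close>
  have U: "U = ball 0 r \<inter> F -` ball 0 R"
    using g sub unfolding U_def homeomorphism_def by auto (metis IntI image_eqI mem_ball_0)
  have gF: "F (g y) = y" if "y \<in> ball 0 R" for y
    using homeomorphism_apply2[OF g] sub that by blast
  then have "F ` U = ball 0 R" unfolding U_def image_image by simp
  moreover have "connected U"
  proof -
    have "continuous_on (ball 0 R) g"
      by (rule continuous_on_subset[OF homeomorphism_cont2[OF g] sub])
    then show ?thesis unfolding U_def by (rule connected_continuous_image) simp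
  qed
  moreover have "open U" unfolding U by (intro continuous_open_preimage contb) auto
  moreover have "0 \<in> U" unfolding U using r R F0 by simp
  moreover have "U \<subseteq> ball 0 r" by (simp add: U)
  ultimately show ?thesis
    unfolding contains_schlicht_disc_def using inj inj_on_subset by blast
qed

section \<open>The equation for the radius\<close>

text \<open>This is the function \<open>\<phi>\<close> of the overview: a Lipschitz constant of
  \<open>F - id\<close> on the closed disc of radius \<open>r\<close>, for
  \<open>0 \<le> r < 1\<close>.\<close>

definition univalence_loss :: "nat \<Rightarrow> real \<Rightarrow> (nat \<Rightarrow> real) \<Rightarrow> real \<Rightarrow> real" where
  "univalence_loss m M \<Lambda> r = (M - 1 / M) * ((2 * r - r\<^sup>2) / (1 - r)\<^sup>2)
     + (\<Sum>k\<in>{1..<m}. (real k + 1) * r ^ k * \<Lambda> k)"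

lemma is_univalence_radius_iff:
  "is_univalence_radius m M \<Lambda> r \<longleftrightarrow> 0 < r \<and> r < 1 \<and> univalence_loss m M \<Lambda> r = 1"
  by (auto simp: is_univalence_radius_def univalence_loss_def)

lemma diff_inverse_nonneg: "M - 1 / M \<ge> 0" if "M \<ge> 1" for M :: real
  using that by (simp add: divide_simps) (metis mult_mono' mult_1 zero_le_one)

text \<open>Each summand is \<open>r\<close> times a nondecreasing function. The factor
  \<open>s / r\<close> expresses this without dividing by \<open>s\<close>, which may be
  \<open>0\<close>. It yields both uniqueness of the root and strict contraction below it.\<close>

lemma univalence_loss_scaling:
  assumes M: "M \<ge> 1" and \<Lambda>: "\<And>k. k \<in> {1..<m} \<Longrightarrow> \<Lambda> k \<ge> 0"
    and s: "0 \<le> s" "s \<le> r" and r: "0 < r" "r < 1"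
  shows "univalence_loss m M \<Lambda> s \<le> (s / r) * univalence_loss m M \<Lambda> r"
proof -
  have "(2 * s - s\<^sup>2) / (1 - s)\<^sup>2 = s * ((2 - s) / (1 - s)\<^sup>2)"
    by (simp add: power2_eq_square algebra_simps)
  \<comment> \<open>Partial fractions make the monotonicity visible term by term.\<close>
  also have "(2 - s) / (1 - s)\<^sup>2 = 1 / (1 - s) + 1 / (1 - s)\<^sup>2"
    using s r by (simp add: divide_simps) (simp add: power2_eq_square algebra_simps)
  also have "s * \<dots> \<le> s * (1 / (1 - r) + 1 / (1 - r)\<^sup>2)"
    using s r by (intro mult_left_mono add_mono divide_left_mono power_mono mult_pos_pos) auto
  also have "1 / (1 - r) + 1 / (1 - r)\<^sup>2 = (2 - r) / (1 - r)\<^sup>2"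
    using r by (simp add: divide_simps) (simp add: power2_eq_square algebra_simps)
  also have "s * ((2 - r) / (1 - r)\<^sup>2) = (s / r) * ((2 * r - r\<^sup>2) / (1 - r)\<^sup>2)"
    using r by (simp add: power2_eq_square divide_simps) (simp add: algebra_simps)
  finally have "(M - 1 / M) * ((2 * s - s\<^sup>2) / (1 - s)\<^sup>2)
      \<le> (M - 1 / M) * ((s / r) * ((2 * r - r\<^sup>2) / (1 - r)\<^sup>2))"
    by (intro mult_left_mono diff_inverse_nonneg M)
  moreover have "(\<Sum>k\<in>{1..<m}. (real k + 1) * s ^ k * \<Lambda> k)
      \<le> (\<Sum>k\<in>{1..<m}. (s / r) * ((real k + 1) * r ^ k * \<Lambda> k))"
  proof (rule sum_mono)
    fix k assume k: "k \<in> {1..<m}"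
    \<comment> \<open>Since \<open>k \<ge> 1\<close>, one factor \<open>s\<close> can be split
      off.\<close>
    then obtain j where j: "k = Suc j" by (cases k) auto
    have "s * s ^ j \<le> s * r ^ j" using s by (intro mult_left_mono power_mono) auto
    then have "s ^ k \<le> (s / r) * r ^ k" using r by (simp add: j)
    then have "(real k + 1) * s ^ k * \<Lambda> k \<le> (real k + 1) * ((s / r) * r ^ k) * \<Lambda> k"
      by (intro mult_left_mono mult_right_mono \<Lambda> k) auto
    then show "(real k + 1) * s ^ k * \<Lambda> k \<le> (s / r) * ((real k + 1) * r ^ k * \<Lambda> k)"
      by (simp add: mult_ac)
  qed
  ultimately show ?thesis
    unfolding univalence_loss_def by (simp add: distrib_left sum_distrib_left mult_ac)
qed

text \<open>At a root the right-hand side is \<open>r\<close>, so the amount subtracted from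
  \<open>r\<close> in the covering radius is at most \<open>r / 2\<close>, and that radius is
  positive. The inequality holds termwise: the rational parts differ by
  \<open>r ^ 3 / (1 - r)\<^sup>2\<close>, and \<open>k + 1 \<ge> 2\<close>.\<close>

lemma univalence_loss_lower_bound:
  assumes M: "M \<ge> 1" and \<Lambda>: "\<And>k. k \<in> {1..<m} \<Longrightarrow> \<Lambda> k \<ge> 0"
    and r: "0 < r" "r < 1"
  shows "2 * ((M - 1 / M) * (r\<^sup>2 / (1 - r)) + (\<Sum>k\<in>{1..<m}. r ^ (k + 1) * \<Lambda> k))
    \<le> r * univalence_loss m M \<Lambda> r"
proof -
  have "2 * (r\<^sup>2 / (1 - r)) \<le> r * ((2 * r - r\<^sup>2) / (1 - r)\<^sup>2)"
  proof -
    have "r * ((2 * r - r\<^sup>2) / (1 - r)\<^sup>2) - 2 * (r\<^sup>2 / (1 - r)) = r ^ 3 / (1 - r)\<^sup>2"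
      using r by (simp add: divide_simps) (simp add: power2_eq_square power3_eq_cube algebra_simps)
    also have "\<dots> \<ge> 0" using r by simp
    finally show ?thesis by simp
  qed
  then have "(M - 1 / M) * (2 * (r\<^sup>2 / (1 - r))) \<le> (M - 1 / M) * (r * ((2 * r - r\<^sup>2) / (1 - r)\<^sup>2))"
    by (intro mult_left_mono diff_inverse_nonneg M)
  moreover have "(\<Sum>k\<in>{1..<m}. 2 * (r ^ (k + 1) * \<Lambda> k))
      \<le> (\<Sum>k\<in>{1..<m}. r * ((real k + 1) * r ^ k * \<Lambda> k))"
  proof (rule sum_mono)
    fix k assume k: "k \<in> {1..<m}"
    then have "2 * (r ^ (k + 1) * \<Lambda> k) \<le> (real k + 1) * (r ^ (k + 1) * \<Lambda> k)"
      using \<Lambda>[OF k] r by (intro mult_right_mono) auto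
    then show "2 * (r ^ (k + 1) * \<Lambda> k) \<le> r * ((real k + 1) * r ^ k * \<Lambda> k)"
      by (simp add: mult_ac)
  qed
  ultimately show ?thesis
    unfolding univalence_loss_def by (simp add: distrib_left sum_distrib_left mult_ac)
qed

text \<open>Existence is the intermediate value theorem, starting from the value \<open>0\<close> at
  \<open>0\<close>. Of two roots \<open>s < r\<close>, the smaller would have loss at most
  \<open>s / r < 1\<close>.\<close>

lemma ex1_univalence_radius:
  assumes M: "M \<ge> 1" and \<Lambda>: "\<And>k. k \<in> {1..<m} \<Longrightarrow> \<Lambda> k \<ge> 0"
    and ex: "M > 1 \<or> (\<Sum>k\<in>{1..<m}. (real k + 1) * \<Lambda> k) > 1"
  shows "\<exists>!r. is_univalence_radius m M \<Lambda> r"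
proof (rule ex_ex1I)
  let ?g = "univalence_loss m M \<Lambda>"
  \<comment> \<open>If the right endpoint is \<open>1\<close>, the strict inequality there keeps the
    root below \<open>1\<close>.\<close>
  obtain s where s: "0 \<le> s" "1 \<le> ?g s" "s < 1 \<or> s = 1 \<and> ?g s > 1" "continuous_on {0..s} ?g"
  proof (cases "M > 1")
    case True
    define c where "c = M - 1 / M"
    have c: "c > 0" using True unfolding c_def by (simp add: divide_simps less_1_mult)
    \<comment> \<open>With \<open>t = 1 - r\<close>, the rational term is
      \<open>c * (1 - t\<^sup>2) / t\<^sup>2\<close>; this \<open>t\<close> makes it equal to
      \<open>1\<close>, and the other terms only add to it.\<close>
    define t where "t = sqrt (c / (1 + c))"
    have t2: "t\<^sup>2 = c / (1 + c)" using c by (simp add: t_def)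
    have t: "0 < t" "t < 1" using c by (auto simp: t_def)
    have "c * ((2 * (1 - t) - (1 - t)\<^sup>2) / (1 - (1 - t))\<^sup>2) = c * ((1 - t\<^sup>2) / t\<^sup>2)"
      by (simp add: power2_eq_square algebra_simps)
    also have "\<dots> = 1" unfolding t2 using c by (simp add: divide_simps)
    finally have "?g (1 - t) \<ge> 1"
      using \<Lambda> t unfolding univalence_loss_def c_def by (auto intro!: sum_nonneg)
    moreover have "continuous_on {0..1 - t} ?g"
      unfolding univalence_loss_def using t by (intro continuous_intros) auto
    ultimately show thesis using that[of "1 - t"] t by auto
  next
    case False
    then have M1: "M = 1" using M by simp
    have g: "?g = (\<lambda>r. \<Sum>k\<in>{1..<m}. (real k + 1) * r ^ k * \<Lambda> k)"
      by (simp add: fun_eq_iff univalence_loss_def M1)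
    have "?g 1 > 1" using ex M1 unfolding g by simp
    moreover have "continuous_on {0..1} ?g" unfolding g by (intro continuous_intros)
    ultimately show thesis using that[of 1] by auto
  qed
  have g0: "?g 0 = 0" unfolding univalence_loss_def by (simp add: power_0_left)
  obtain r where r: "0 \<le> r" "r \<le> s" "?g r = 1"
    using IVT'[of ?g 0 1 s] s g0 by auto
  then have "r \<noteq> 0" using g0 by auto
  moreover have "r < 1" using r s(3) by (cases "r = s") auto
  ultimately show "\<exists>r. is_univalence_radius m M \<Lambda> r"
    using r by (intro exI[of _ r]) (simp add: is_univalence_radius_iff)
next
  have False if "is_univalence_radius m M \<Lambda> r" "is_univalence_radius m M \<Lambda> s" "s < r" for r s
    using univalence_loss_scaling[of M m \<Lambda> s r] that M \<Lambda>
    by (auto simp: is_univalence_radius_iff divide_simps)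
  then show "r = s" if "is_univalence_radius m M \<Lambda> r" "is_univalence_radius m M \<Lambda> s" for r s
    using that by (meson linorder_neqE_linordered_idom)
qed

section \<open>Contraction, univalence and the covered disc\<close>

theorem theorem3p2:
  fixes m :: nat and M :: real and \<Lambda> :: "nat \<Rightarrow> real"
    and f :: "nat \<Rightarrow> complex \<Rightarrow> complex" and F :: "complex \<Rightarrow> complex"
  assumes "m \<ge> 1"
    and "\<And>k. k < m \<Longrightarrow> f k holomorphic_on ball 0 1"
    and "\<And>z. z \<in> ball 0 1 \<Longrightarrow> F z = (\<Sum>k<m. cnj z ^ k * f k z)"
    and "\<And>k. k < m \<Longrightarrow> f k 0 = 0"
    and "wirtinger_z F 0 = 1"
    and "\<And>z. z \<in> ball 0 1 \<Longrightarrow> norm (f 0 z) < M"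
    and "\<And>k z. k \<in> {1..<m} \<Longrightarrow> z \<in> ball 0 1 \<Longrightarrow> norm (deriv (f k) z) \<le> \<Lambda> k"
  shows "(\<forall>k\<in>{1..<m}. \<Lambda> k \<ge> 0) \<and> M \<ge> 1 \<and>
    (M > 1 \<or> (\<Sum>k\<in>{1..<m}. (real k + 1) * \<Lambda> k) > 1 \<longrightarrow>
       (\<exists>!r. is_univalence_radius m M \<Lambda> r)) \<and>
    (\<forall>r\<^sub>2 R\<^sub>2. is_univalence_radius m M \<Lambda> r\<^sub>2 \<longrightarrow>
       R\<^sub>2 = r\<^sub>2 - (M - 1 / M) * (r\<^sub>2\<^sup>2 / (1 - r\<^sub>2)) - (\<Sum>k\<in>{1..<m}. r\<^sub>2 ^ (k + 1) * \<Lambda> k) \<longrightarrow>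
       inj_on F (ball 0 r\<^sub>2) \<and> contains_schlicht_disc F (ball 0 r\<^sub>2) R\<^sub>2)"
proof -
  have hol: "f k holomorphic_on ball 0 1" if "k < m" for k using assms(2) that .
  have F: "F z = (\<Sum>k<m. cnj z ^ k * f k z)" if "norm z < 1" for z using assms(3) that by simp
  have f0: "f k 0 = 0" if "k < m" for k using assms(4) that .
  have df0: "deriv (f 0) 0 = 1"
    using wirtinger_z_0[OF assms(1-4)] assms(5) by simp
  have lt: "norm (f 0 z) < M" if "norm z < 1" for z using assms(6) that by simp
  have dbd: "norm (deriv (f k) z) \<le> \<Lambda> k" if "k \<in> {1..<m}" "norm z < 1" for k z
    using assms(7) that by simp
  have hol0: "f 0 holomorphic_on ball 0 1" and f00: "f 0 0 = 0" using assms(1) hol f0 by auto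
  have \<Lambda>: "\<Lambda> k \<ge> 0" if "k \<in> {1..<m}" for k
    using order_trans[OF norm_ge_zero dbd[OF that, of 0]] by simp
  have M: "M \<ge> 1" by (rule normalized_bounded_coeffs(1)[OF hol0 f00 df0 lt])
  have split: "F z = f 0 z + (\<Sum>k\<in>{1..<m}. cnj z ^ k * f k z)" if "norm z < 1" for z
    using assms(1) by (simp add: F[OF that] lessThan_atLeast0 sum.atLeast_Suc_lessThan)
  \<comment> \<open>The Lipschitz bound for \<open>F - id\<close>: the derivative estimate handles
    \<open>f 0 z - z\<close>, and the product-rule estimate handles the terms with
    \<open>k \<ge> 1\<close>.\<close>
  have diff: "norm (F z - F w - (z - w)) \<le> univalence_loss m M \<Lambda> \<rho> * norm (z - w)"
    if \<rho>: "\<rho> < 1" and zw: "norm z \<le> \<rho>" "norm w \<le> \<rho>" for z w \<rho>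
  proof -
    let ?A = "(M - 1 / M) * ((2 * \<rho> - \<rho>\<^sup>2) / (1 - \<rho>)\<^sup>2)"
    have n1: "norm ((f 0 z - z) - (f 0 w - w)) \<le> ?A * norm (z - w)"
    proof (rule field_differentiable_bound[where S = "cball 0 \<rho>" and f' = "\<lambda>u. deriv (f 0) u - 1"])
      fix u :: complex assume "u \<in> cball 0 \<rho>"
      then have u: "norm u \<le> \<rho>" "norm u < 1" using \<rho> by auto
      have "(f 0 has_field_derivative deriv (f 0) u) (at u)"
        using holomorphic_derivI[OF hol0, of u] u by simp
      then show "((\<lambda>u. f 0 u - u) has_field_derivative deriv (f 0) u - 1) (at u within cball 0 \<rho>)"
        by (rule has_field_derivative_at_within[OF DERIV_diff[OF _ DERIV_ident]])
      have eq: "(2 * s - s\<^sup>2) / (1 - s)\<^sup>2 = 1 / (1 - s)\<^sup>2 - 1" if "s < 1" for s :: real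
        using that by (simp add: divide_simps) (simp add: power2_eq_square algebra_simps)
      have "(2 * norm u - (norm u)\<^sup>2) / (1 - norm u)\<^sup>2 \<le> (2 * \<rho> - \<rho>\<^sup>2) / (1 - \<rho>)\<^sup>2"
        unfolding eq[OF u(2)] eq[OF \<rho>] using u \<rho>
        by (intro diff_right_mono divide_left_mono power_mono mult_pos_pos) auto
      then have "(M - 1 / M) * ((2 * norm u - (norm u)\<^sup>2) / (1 - norm u)\<^sup>2) \<le> ?A"
        by (intro mult_left_mono diff_inverse_nonneg M)
      with normalized_bounded_estimates(2)[OF hol0 f00 df0 lt u(2)]
      show "norm (deriv (f 0) u - 1) \<le> ?A" by simp
    qed (use zw in simp_all)
    have n2: "norm (\<Sum>k\<in>{1..<m}. cnj z ^ k * f k z - cnj w ^ k * f k w)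
        \<le> (\<Sum>k\<in>{1..<m}. (real k + 1) * \<rho> ^ k * \<Lambda> k * norm (z - w))"
    proof (rule sum_norm_le)
      fix k assume k: "k \<in> {1..<m}"
      then have "k < m" by simp
      from conj_power_mult_diff_bound[OF hol[OF this] f0[OF this] dbd[OF k] \<rho> zw]
      show "norm (cnj z ^ k * f k z - cnj w ^ k * f k w) \<le> (real k + 1) * \<rho> ^ k * \<Lambda> k * norm (z - w)" .
    qed
    have eq: "F z - F w - (z - w) = ((f 0 z - z) - (f 0 w - w))
        + (\<Sum>k\<in>{1..<m}. cnj z ^ k * f k z - cnj w ^ k * f k w)"
      using split[of z] split[of w] zw \<rho> by (simp add: sum_subtractf)
    have "norm (F z - F w - (z - w))
        \<le> ?A * norm (z - w) + (\<Sum>k\<in>{1..<m}. (real k + 1) * \<rho> ^ k * \<Lambda> k * norm (z - w))"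
      unfolding eq by (rule norm_triangle_mono[OF n1 n2])
    then show ?thesis by (simp add: univalence_loss_def distrib_right sum_distrib_right)
  qed
  have "inj_on F (ball 0 r) \<and> contains_schlicht_disc F (ball 0 r) R"
    if rad: "is_univalence_radius m M \<Lambda> r"
      and R: "R = r - (M - 1 / M) * (r\<^sup>2 / (1 - r)) - (\<Sum>k\<in>{1..<m}. r ^ (k + 1) * \<Lambda> k)" for r R
  proof -
    have r: "0 < r" "r < 1" and loss: "univalence_loss m M \<Lambda> r = 1"
      using rad by (auto simp: is_univalence_radius_iff)
    have inj: "inj_on F (ball 0 r)"
    proof (rule inj_onI, rule ccontr)
      fix z w assume z: "z \<in> ball 0 r" and w: "w \<in> ball 0 r" and eq: "F z = F w" and ne: "z \<noteq> w"
      \<comment> \<open>At \<open>r\<close> itself the Lipschitz constant is \<open>1\<close>. Two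
        points of the open disc lie in a closed disc of radius \<open>\<rho> < r\<close>, where it
        is at most \<open>\<rho> / r < 1\<close>.\<close>
      define \<rho> where "\<rho> = max (norm z) (norm w)"
      have \<rho>: "norm z \<le> \<rho>" "norm w \<le> \<rho>" "0 \<le> \<rho>" "\<rho> < r"
        using z w by (auto simp: \<rho>_def le_max_iff_disj)
      have "univalence_loss m M \<Lambda> \<rho> \<le> \<rho> / r"
        using univalence_loss_scaling[of M m \<Lambda> \<rho> r] M \<Lambda> \<rho> r loss by simp
      also have "\<dots> < 1" using \<rho> r by simp
      finally have "univalence_loss m M \<Lambda> \<rho> * norm (z - w) < norm (z - w)" using ne by simp
      moreover have "norm (z - w) \<le> univalence_loss m M \<Lambda> \<rho> * norm (z - w)"
        using diff[of \<rho> z w] \<rho> r eq by (simp add: norm_minus_commute)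
      ultimately show False by simp
    qed
    have "contains_schlicht_disc F (ball 0 r) R"
    proof (rule contains_schlicht_disc_if_boundary_bound[OF _ inj _ r(1)])
      have sub: "cball (0::complex) r \<subseteq> ball 0 1" using r by auto
      have "continuous_on (cball 0 r) (\<lambda>z. \<Sum>k<m. cnj z ^ k * f k z)"
        by (intro continuous_intros continuous_on_subset[OF holomorphic_on_imp_continuous_on[OF hol] sub]) auto
      then show "continuous_on (cball 0 r) F"
        by (rule continuous_on_eq) (use F r in auto)
      show "F 0 = 0" using F[of 0] f0 by simp
      show "R > 0"
        using univalence_loss_lower_bound[of M m \<Lambda> r] M \<Lambda> r loss unfolding R by simp
      fix z :: complex assume z: "norm z = r"
      then have z1: "norm z < 1" using r by simp
      have "norm (f 0 z - z) \<le> (M - 1 / M) * (r\<^sup>2 / (1 - r))"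
        using normalized_bounded_estimates(1)[OF hol0 f00 df0 lt z1] z by simp
      moreover have "norm (\<Sum>k\<in>{1..<m}. cnj z ^ k * f k z) \<le> (\<Sum>k\<in>{1..<m}. r ^ (k + 1) * \<Lambda> k)"
      proof (rule sum_norm_le)
        fix k assume k: "k \<in> {1..<m}"
        then have "k < m" by simp
        \<comment> \<open>Exponent \<open>0\<close> and second point \<open>0\<close> leave just the
          growth bound on \<open>f k\<close>; exponent \<open>k\<close> would cost a factor
          \<open>k + 1\<close>.\<close>
        from conj_power_mult_diff_bound[OF hol[OF this] f0[OF this] dbd[OF k] r(2), of z 0 0]
        have "norm (f k z) \<le> \<Lambda> k * r" using z r f0[OF \<open>k < m\<close>] by simp
        then have "r ^ k * norm (f k z) \<le> r ^ k * (\<Lambda> k * r)" using r by (intro mult_left_mono) auto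
        then show "norm (cnj z ^ k * f k z) \<le> r ^ (k + 1) * \<Lambda> k"
          using z by (simp add: norm_mult norm_power mult_ac)
      qed
      moreover have "norm z \<le> norm (F z) + norm (f 0 z - z) + norm (\<Sum>k\<in>{1..<m}. cnj z ^ k * f k z)"
      proof -
        have "z = F z - (f 0 z - z) - (\<Sum>k\<in>{1..<m}. cnj z ^ k * f k z)" by (simp add: split[OF z1])
        then show ?thesis by (smt (verit) norm_triangle_ineq4)
      qed
      ultimately show "R \<le> norm (F z)" using z unfolding R by linarith
    qed
    with inj show ?thesis by simp
  qed
  with \<Lambda> M ex1_univalence_radius[of M m \<Lambda>] show ?thesis by blast
qed

end
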